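(* Let $N$ be a finite nonempty set of players. The coalitional value $\Gamma^C$ satisfies the properties of additivity, necessary players get the $0$-normalized per capita coalitional mean, efficiency, symmetry inside unions and symmetry among unions, and it is the unique coalitional value $g:\mathcal{G}_N^{cs}\to\mathbb{R}^N$ that satisfies these five properties.
   Context: Fix a finite nonempty set $N$. A cooperative game with player set $N$ is a pair $(N,v)$ with $v:2^N\to\mathbb{R}$, $v(\emptyset)=0$. A coalition structure on $N$ is a partition $P=\{P_1,\dots,P_m\}$ of $N$ into nonempty sets (unions); $M=\{1,\dots,m\}$, $p_k=|P_k|$. A cooperative game with a coalition structure is a triple $(N,v,P)$; $\mathcal{G}_N^{cs}$ is the set of all of them (all $v$, all $P$). A coalitional value is a map $g$ assigning to each $(N,v,P)\in\mathcal{G}_N^{cs}$ a vector $g(N,v,P)\in\mathbb{R}^N$. $\subset$ denotes strict inclusion. For $R\subseteq M$ write $P_R=\bigcup_{l\in R}P_l$. A player $i\in N$ is necessary in $(N,v)$ if $v(S)=0$ for all $S\subseteq N\setminus\{i\}$. Players $i,j$ are symmetric in $(N,v)$ if $v(S\cup\{i\})=v(S\cup\{j\})$ for every $S\subseteq N\setminus\{i,j\}$. Unions $P_k,P_l$ are symmetric in $(N,v,P)$ if $v(P_R\cup P_k)=v(P_R\cup P_l)$ for every $R\subseteq M\setminus\{k,l\}$. The coalitional value $\gamma^C$ is given, for $i\in P_k$, by $$\gamma^C_i(N,v,P)=\frac{1}{2^{m-1}}\frac{1}{2^{p_k-1}}\left(\sum_{R\subseteq M\setminus\{k\}}\ \sum_{T\subset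 P_k,\, i\in T}\frac{v(P_R\cup T)}{|T|}-\sum_{R\subseteq M\setminus\{k\}}\ \sum_{T\subset P_k,\, i\notin T,\, T\ne\emptyset}\frac{v(P_R\cup T)}{p_k-|T|}\right)$$ $$+\frac{1}{2^{m-1}}\frac{1}{p_k}\left(\sum_{R\subset M,\, k\in R}\frac{v(P_R)}{|R|}-\sum_{R\subseteq M\setminus\{k\}}\frac{v(P_R)}{m-|R|}\right)+\frac{v(N)}{m\,p_k}.$$ For $(N,v,P)$ define $v^{0'}(S)=v(S)-\sum_{r\in R_S}v(P_r)-\sum_{j\in S\setminus\bigcup_{r\in R_S}P_r}v(\{j\})$, where $R_S=\{r\in M: P_r\subseteq S\}$, for all $S\subseteq N$. The coalitional value $\Gamma^C$ is, for $i\in P_k$, $$\Gamma^C_i(N,v,P)=v(\{i\})+\frac{v(P_k)-\sum_{j\in P_k}v(\{j\})}{p_k}+\gamma^C_i(N,v^{0'},P).$$ Properties of a coalitional value $g$: - Additivity: $g(N,v+w,P)=g(N,v,P)+g(N,w,P)$ for all $v,w,P$. - Efficiency: $\sum_{i\in N}g_i(N,v,P)=v(N)$ for all $(N,v,P)$. - Symmetry inside unions: $g_i(N,v,P)=g_j(N,v,P)$ for all $(N,v,P)$ and all $i,j$ in the same union $P_k\in P$ that are symmetric in $(N,v)$. - Symmetry among unions: $\sum_{i\in P_k}g_i(N,v,P)=\sum_{j\in P_l}g_j(N,v,P)$ for all $(N,v,P)$ and all $P_k,P_l\in P$ symmetric in $(N,v,P)$. - Necessary players get the $0$-normalized per capita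 coalitional mean: for every $(N,v,P)$ with $v(N)=\sum_{r\in M}v(P_r)$ and every player $i\in P_k$ necessary in $(N,v)$, $$g_i(N,v,P)=v(\{i\})+\frac{v(P_k)-\sum_{j\in P_k}v(\{j\})}{p_k}+\frac{1}{2^{m-1}}\frac{1}{2^{p_k-1}}\sum_{R\subseteq M\setminus\{k\}}\ \sum_{\emptyset\ne T\subset P_k}\frac{v^{0'}(P_R\cup T)}{|T|}+\frac{1}{2^{m-1}}\frac{1}{p_k}\sum_{\emptyset\neq R\subseteq M}\frac{v^{0'}(P_R)}{|R|}.$$ *)

theory Defs
  imports Complex_Main "HOL-Library.Disjoint_Sets"
begin

text \<open>
  The player set \<open>N\<close> is the universe of an arbitrary type \<open>'n :: finite\<close>. A coalition structure is
  the set of its unions, so a set of union indices \<open>R \<subseteq> M\<close> is a subset \<open>R \<subseteq> P\<close>, and \<open>P\<^sub>R\<close> is \<open>\<Union>R\<close>.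
\<close>

type_synonym 'n game = "'n set \<Rightarrow> real"
type_synonym 'n coal_value = "'n game \<Rightarrow> 'n set set \<Rightarrow> 'n \<Rightarrow> real"

definition cs_games :: "('n::finite game \<times> 'n set set) set" where
  "cs_games = {(v, P). v {} = 0 \<and> partition_on UNIV P}"

definition union_of :: "'n::finite set set \<Rightarrow> 'n \<Rightarrow> 'n set" where
  "union_of P i = (THE K. K \<in> P \<and> i \<in> K)"

definition necessary :: "'n::finite game \<Rightarrow> 'n \<Rightarrow> bool" where
  "necessary v i \<longleftrightarrow> (\<forall>S. S \<subseteq> UNIV - {i} \<longrightarrow> v S = 0)"

definition symmetric_players :: "'n::finite game \<Rightarrow> 'n \<Rightarrow> 'n \<Rightarrow> bool" where
  "symmetric_players v i j \<longleftrightarrow> (\<forall>S. S \<subseteq> UNIV - {i, j} \<longrightarrow> v (S \<union> {i}) = v (S \<union> {j}))"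

definition symmetric_unions :: "'n::finite game \<Rightarrow> 'n set set \<Rightarrow> 'n set \<Rightarrow> 'n set \<Rightarrow> bool" where
  "symmetric_unions v P K L \<longleftrightarrow> (\<forall>R. R \<subseteq> P - {K, L} \<longrightarrow> v (\<Union>R \<union> K) = v (\<Union>R \<union> L))"

definition gamma_C :: "'n::finite coal_value" where
  "gamma_C v P i = (let K = union_of P i; m = card P; p = card K in
     1 / 2 ^ (m - 1) * (1 / 2 ^ (p - 1)) *
       ((\<Sum>R | R \<subseteq> P - {K}. \<Sum>T | T \<subset> K \<and> i \<in> T. v (\<Union>R \<union> T) / real (card T))
        - (\<Sum>R | R \<subseteq> P - {K}. \<Sum>T | T \<subset> K \<and> i \<notin> T \<and> T \<noteq> {}.
             v (\<Union>R \<union> T) / (real p - real (card T))))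
     + 1 / 2 ^ (m - 1) * (1 / real p) *
       ((\<Sum>R | R \<subset> P \<and> K \<in> R. v (\<Union>R) / real (card R))
        - (\<Sum>R | R \<subseteq> P - {K}. v (\<Union>R) / (real m - real (card R))))
     + v UNIV / (real m * real p))"

definition zero_normalized :: "'n::finite game \<Rightarrow> 'n set set \<Rightarrow> 'n game" where
  "zero_normalized v P S = (let R = {K \<in> P. K \<subseteq> S} in
     v S - (\<Sum>K\<in>R. v K) - (\<Sum>j\<in>S - \<Union>R. v {j}))"

definition Gamma_C :: "'n::finite coal_value" where
  "Gamma_C v P i = (let K = union_of P i in
     v {i} + (v K - (\<Sum>j\<in>K. v {j})) / real (card K) + gamma_C (zero_normalized v P) P i)"

definition additivity :: "'n::finite coal_value \<Rightarrow> bool" where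
  "additivity g \<longleftrightarrow> (\<forall>v w P. (v, P) \<in> cs_games \<longrightarrow> (w, P) \<in> cs_games \<longrightarrow>
     (\<forall>i. g (\<lambda>S. v S + w S) P i = g v P i + g w P i))"

definition efficiency :: "'n::finite coal_value \<Rightarrow> bool" where
  "efficiency g \<longleftrightarrow> (\<forall>(v, P)\<in>cs_games. (\<Sum>i\<in>UNIV. g v P i) = v UNIV)"

definition symmetry_inside_unions :: "'n::finite coal_value \<Rightarrow> bool" where
  "symmetry_inside_unions g \<longleftrightarrow> (\<forall>(v, P)\<in>cs_games. \<forall>K\<in>P. \<forall>i\<in>K. \<forall>j\<in>K.
     symmetric_players v i j \<longrightarrow> g v P i = g v P j)"

definition symmetry_among_unions :: "'n::finite coal_value \<Rightarrow> bool" where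
  "symmetry_among_unions g \<longleftrightarrow> (\<forall>(v, P)\<in>cs_games. \<forall>K\<in>P. \<forall>L\<in>P.
     symmetric_unions v P K L \<longrightarrow> (\<Sum>i\<in>K. g v P i) = (\<Sum>j\<in>L. g v P j))"

definition necessary_players_mean :: "'n::finite coal_value \<Rightarrow> bool" where
  "necessary_players_mean g \<longleftrightarrow> (\<forall>(v, P)\<in>cs_games. v UNIV = (\<Sum>K\<in>P. v K) \<longrightarrow>
     (\<forall>K\<in>P. \<forall>i\<in>K. necessary v i \<longrightarrow>
       g v P i = v {i} + (v K - (\<Sum>j\<in>K. v {j})) / real (card K)
         + 1 / 2 ^ (card P - 1) * (1 / 2 ^ (card K - 1)) *
           (\<Sum>R | R \<subseteq> P - {K}. \<Sum>T | T \<noteq> {} \<and> T \<subset> K.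
              zero_normalized v P (\<Union>R \<union> T) / real (card T))
         + 1 / 2 ^ (card P - 1) * (1 / real (card K)) *
           (\<Sum>R | R \<noteq> {} \<and> R \<subseteq> P. zero_normalized v P (\<Union>R) / real (card R))))"

end

theory Submission imports Defs "HOL-Combinatorics.Transposition" begin

text \<open>
  Both bracketed sums in \<open>gamma_C\<close> are instances of one operator \<open>share\<close>, taken over the players
  of a union and over the set of unions: each coalition divides its worth among its members and
  collects it from the others, so shares add up to zero. This gives efficiency and, with the
  invariance of \<open>share\<close> under transpositions, both symmetries. For uniqueness, additivity reduces
  the claim to games charging a single coalition \<open>Z\<close>. There the members of \<open>Z\<close> are necessary,
  while the remaining players and unions are symmetric, so efficiency fixes all payoffs.
\<close>

section \<open>Dividing and collecting worth within a finite set\<close>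

text \<open>Only proper subsets enter: \<open>A\<close> itself has no outsiders who could pay, so
  its worth would spoil the zero total. The empty set does enter, as a charge on everybody.\<close>

definition share :: "'a set \<Rightarrow> ('a set \<Rightarrow> real) \<Rightarrow> 'a \<Rightarrow> real" where
  "share A f i = (\<Sum>T | T \<subset> A. if i \<in> T then f T / real (card T)
                              else - (f T / (real (card A) - real (card T))))"

lemma finite_psubsets: "finite A \<Longrightarrow> finite {T. T \<subset> A}"
  by (rule finite_subset[of _ "Pow A"]) auto

lemma share_split:
  assumes "finite A"
  shows "share A f i = (\<Sum>T | T \<subset> A \<and> i \<in> T. f T / real (card T))
    - (\<Sum>T | T \<subset> A \<and> i \<notin> T. f T / (real (card A) - real (card T)))"
  unfolding share_def
  by (subst sum.If_cases[OF finite_psubsets[OF assms]])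
     (simp add: Collect_conj_eq[symmetric] Collect_neg_eq[symmetric] sum_negf)

lemma share_add: "share A (\<lambda>T. f T + h T) i = share A f i + share A h i"
  unfolding share_def sum.distrib[symmetric]
  by (rule sum.cong) (auto simp: add_divide_distrib)

lemma share_cong: "(\<And>T. T \<subset> A \<Longrightarrow> f T = h T) \<Longrightarrow> share A f i = share A h i"
  unfolding share_def by (rule sum.cong) auto

text \<open>For a fixed nonempty \<open>T\<close>, the members receive \<open>f T\<close> in total
  and the outsiders pay \<open>f T\<close> in total. The empty coalition has payers but no
  receivers, hence the condition \<open>f {} = 0\<close>.\<close>

lemma sum_share:
  assumes "finite A" "f {} = 0"
  shows "(\<Sum>i\<in>A. share A f i) = 0"
proof -
  have "(\<Sum>i\<in>A. if i \<in> T then f T / real (card T)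
           else - (f T / (real (card A) - real (card T)))) = 0" (is "?s = 0") if T: "T \<subset> A" for T
  proof (cases "T = {}")
    case False
    have fin: "finite T" and sub: "T \<subseteq> A" using T assms(1) by (auto intro: finite_subset)
    have "?s = real (card T) * (f T / real (card T))
        - real (card (A - T)) * (f T / (real (card A) - real (card T)))"
      using T assms(1) by (subst sum.If_cases) (auto simp: Int_absorb1 Diff_eq[symmetric])
    moreover have "card T < card A" using T assms(1) by (rule psubset_card_mono[rotated])
    moreover have "card T \<noteq> 0" using False fin by simp
    ultimately show ?thesis
      using card_Diff_subset[OF fin sub] by (simp add: of_nat_diff)
  qed (use assms in simp)
  then show ?thesis
    unfolding share_def by (subst sum.swap) simp
qed

text \<open>The sum is reindexed along the transposition of \<open>i\<close> and \<open>j\<close>,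
  which permutes the proper subsets of \<open>A\<close>, keeps cardinalities and, by
  \<open>sym\<close>, keeps worths.\<close>

lemma share_symmetric:
  assumes A: "finite A" "i \<in> A" "j \<in> A"
    and sym: "\<And>S. S \<subseteq> A - {i, j} \<Longrightarrow> f (insert i S) = f (insert j S)"
  shows "share A f i = share A f j"
proof -
  let ?t = "transpose i j"
  have f_swap: "f (?t ` T) = f T" if "T \<subset> A" for T
  proof (cases "i \<in> T \<longleftrightarrow> j \<in> T")
    case True
    then show ?thesis by (simp add: transpose_image_eq)
  next
    case False
    let ?S = "T - {i, j}"
    have fix_S: "?t ` ?S = ?S" by (rule transpose_image_eq) simp
    have S: "?S \<subseteq> A - {i, j}" using that by auto
    from False consider "T = insert i ?S" | "T = insert j ?S" by auto
    then show ?thesis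
    proof cases
      case 1
      then have "?t ` T = insert j ?S"
        by (metis fix_S image_insert transpose_apply_first)
      with 1 sym[OF S] show ?thesis by simp
    next
      case 2
      then have "?t ` T = insert i ?S"
        by (metis fix_S image_insert transpose_apply_second)
      with 2 sym[OF S] show ?thesis by simp
    qed
  qed
  have im_A: "?t ` A = A" using A by (simp add: transpose_image_eq)
  have psub: "?t ` T \<subset> A" if "T \<subset> A" for T
    using that im_A by (metis inj_image_eq_iff inj_transpose image_mono psubset_eq)
  have mem: "j \<in> ?t ` T \<longleftrightarrow> i \<in> T" for T
    by (metis inj_image_mem_iff inj_transpose transpose_apply_first)
  have card: "card (?t ` T) = card T" for T
    by (simp add: card_image)
  show ?thesis
    unfolding share_def
    by (rule sum.reindex_bij_witness[where i = "image ?t" and j = "image ?t"])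
       (auto simp: psub mem card f_swap image_image)
qed

text \<open>Coalitions without \<open>i\<close> are worthless, so \<open>i\<close> pays nothing, and
  the sum of what \<open>i\<close> receives may run over them as well.\<close>

lemma share_necessary:
  assumes "finite A" "\<And>T. i \<notin> T \<Longrightarrow> f T = 0"
  shows "share A f i = (\<Sum>T | T \<noteq> {} \<and> T \<subset> A. f T / real (card T))"
proof -
  have "share A f i = (\<Sum>T | T \<subset> A. f T / real (card T))"
    unfolding share_def by (rule sum.cong) (auto simp: assms(2))
  also have "\<dots> = (\<Sum>T | T \<noteq> {} \<and> T \<subset> A. f T / real (card T))"
    by (rule sum.mono_neutral_right) (use finite_psubsets[OF assms(1)] in auto)
  finally show ?thesis .
qed

section \<open>Basic facts about coalition structures\<close>

context
  fixes P :: "'n::finite set set"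
  assumes P: "partition_on UNIV P"
begin

lemma blocks_eq: "K \<in> P \<Longrightarrow> L \<in> P \<Longrightarrow> i \<in> K \<Longrightarrow> i \<in> L \<Longrightarrow> K = L"
  using partition_onD2[OF P] unfolding disjoint_def by blast

lemma union_of_eq: "K \<in> P \<Longrightarrow> i \<in> K \<Longrightarrow> union_of P i = K"
  unfolding union_of_def by (rule the_equality) (auto dest: blocks_eq)

lemma block_nonempty: "K \<in> P \<Longrightarrow> K \<noteq> {}"
  using partition_onD3[OF P] by auto

lemma ex_block: "\<exists>K\<in>P. i \<in> K"
  using partition_onD1[OF P] by auto

text \<open>A union inside \<open>\<Union>R\<close> is nonempty, so it meets a member of
  \<open>R\<close> and coincides with it by disjointness.\<close>

lemma blocks_in_Union: "R \<subseteq> P \<Longrightarrow> {K \<in> P. K \<subseteq> \<Union>R} = R"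
  using blocks_eq block_nonempty by blast

lemma sum_blocks: "(\<Sum>i\<in>UNIV. f i) = (\<Sum>K\<in>P. \<Sum>i\<in>K. f i :: real)"
proof -
  have "(\<Sum>i\<in>\<Union>P. f i) = (\<Sum>K\<in>P. \<Sum>i\<in>K. f i)"
    using partition_onD2[OF P] by (subst sum.Union_disjoint) (auto simp: disjoint_def)
  then show ?thesis using partition_onD1[OF P] by simp
qed

section \<open>Totals, symmetry and necessary players for \<open>gamma_C\<close>\<close>

text \<open>The inner sums of \<open>gamma_C\<close> leave out \<open>T = {}\<close>, where
  \<open>v (\<Union>R)\<close> may be nonzero; \<open>share\<close> keeps it, so the worth is set to
  0 there. The outer sums are the share of \<open>K\<close> in the quotient game
  \<open>\<lambda>R. v (\<Union>R)\<close>.\<close>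

lemma gamma_C_share:
  assumes K: "K \<in> P" "i \<in> K" and v: "v {} = 0"
  shows "gamma_C v P i =
    1 / 2 ^ (card P - 1) * (1 / 2 ^ (card K - 1)) *
      (\<Sum>R | R \<subseteq> P - {K}. share K (\<lambda>T. if T = {} then 0 else v (\<Union>R \<union> T)) i)
    + 1 / 2 ^ (card P - 1) * (1 / real (card K)) * share P (\<lambda>R. v (\<Union>R)) K
    + v UNIV / (real (card P) * real (card K))"
proof -
  have inner: "share K (\<lambda>T. if T = {} then 0 else v (\<Union>R \<union> T)) i =
      (\<Sum>T | T \<subset> K \<and> i \<in> T. v (\<Union>R \<union> T) / real (card T))
      - (\<Sum>T | T \<subset> K \<and> i \<notin> T \<and> T \<noteq> {}. v (\<Union>R \<union> T) / (real (card K) - real (card T)))" for R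
    unfolding share_split[OF finite]
    by (intro arg_cong2[where f = minus] sum.cong sum.mono_neutral_cong_right) auto
  have "{R. R \<subseteq> P - {K}} = {R. R \<subset> P \<and> K \<notin> R}" using K by auto
  then have outer: "share P (\<lambda>R. v (\<Union>R)) K = (\<Sum>R | R \<subset> P \<and> K \<in> R. v (\<Union>R) / real (card R))
      - (\<Sum>R | R \<subseteq> P - {K}. v (\<Union>R) / (real (card P) - real (card R)))"
    by (simp add: share_split)
  show ?thesis
    unfolding gamma_C_def Let_def union_of_eq[OF K] inner outer sum_subtractf ..
qed

text \<open>The inner shares cancel within \<open>K\<close> by \<open>sum_share\<close>; the other
  two terms are the same for all members of \<open>K\<close>, so their factor
  \<open>1 / card K\<close> disappears.\<close>

lemma sum_gamma_C:
  assumes K: "K \<in> P" and v: "v {} = 0"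
  shows "(\<Sum>i\<in>K. gamma_C v P i) =
    1 / 2 ^ (card P - 1) * share P (\<lambda>R. v (\<Union>R)) K + v UNIV / real (card P)"
proof -
  have zero: "(\<Sum>i\<in>K. \<Sum>R | R \<subseteq> P - {K}. share K (\<lambda>T. if T = {} then 0 else v (\<Union>R \<union> T)) i) = 0"
    by (subst sum.swap) (simp add: sum_share)
  have "card K \<noteq> 0" using block_nonempty[OF K] by simp
  then show ?thesis
    by (simp add: gamma_C_share[OF K] v sum.distrib sum_distrib_left[symmetric]
        sum_divide_distrib[symmetric] zero)
qed

lemma gamma_C_add:
  assumes "v {} = 0" "w {} = 0"
  shows "gamma_C (\<lambda>S. v S + w S) P i = gamma_C v P i + gamma_C w P i"
proof -
  obtain K where K: "K \<in> P" "i \<in> K" using ex_block by auto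
  have "share K (\<lambda>T. if T = {} then 0 else v (\<Union>R \<union> T) + w (\<Union>R \<union> T)) i =
      share K (\<lambda>T. if T = {} then 0 else v (\<Union>R \<union> T)) i
      + share K (\<lambda>T. if T = {} then 0 else w (\<Union>R \<union> T)) i" for R
    unfolding share_add[symmetric] by (rule share_cong) simp
  then show ?thesis
    by (simp add: gamma_C_share[OF K] assms share_add sum.distrib distrib_left add_divide_distrib)
qed

text \<open>Only the inner shares depend on the player. The unions in \<open>R\<close> are disjoint
  from \<open>K\<close>, so \<open>\<Union>R \<union> S\<close> avoids \<open>i\<close> and
  \<open>j\<close> and their symmetry applies.\<close>

lemma gamma_C_symmetric:
  assumes K: "K \<in> P" "i \<in> K" "j \<in> K" and v: "v {} = 0" and sym: "symmetric_players v i j"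
  shows "gamma_C v P i = gamma_C v P j"
proof -
  have "share K (\<lambda>T. if T = {} then 0 else v (\<Union>R \<union> T)) i =
      share K (\<lambda>T. if T = {} then 0 else v (\<Union>R \<union> T)) j" if R: "R \<subseteq> P - {K}" for R
  proof (rule share_symmetric)
    fix S assume "S \<subseteq> K - {i, j}"
    then have "\<Union>R \<union> S \<subseteq> UNIV - {i, j}" using R K blocks_eq by blast
    then have "v (\<Union>R \<union> S \<union> {i}) = v (\<Union>R \<union> S \<union> {j})"
      using sym unfolding symmetric_players_def by blast
    then show "(if insert i S = {} then 0 else v (\<Union>R \<union> insert i S)) =
        (if insert j S = {} then 0 else v (\<Union>R \<union> insert j S))" by simp
  qed (use K in auto)
  then show ?thesis
    by (simp add: gamma_C_share[OF K(1)] K v)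
qed

lemma gamma_C_necessary:
  assumes K: "K \<in> P" "i \<in> K" and v: "v {} = 0" "v UNIV = 0" and nec: "necessary v i"
  shows "gamma_C v P i =
    1 / 2 ^ (card P - 1) * (1 / 2 ^ (card K - 1)) *
      (\<Sum>R | R \<subseteq> P - {K}. \<Sum>T | T \<noteq> {} \<and> T \<subset> K. v (\<Union>R \<union> T) / real (card T))
    + 1 / 2 ^ (card P - 1) * (1 / real (card K)) *
      (\<Sum>R | R \<noteq> {} \<and> R \<subseteq> P. v (\<Union>R) / real (card R))"
proof -
  have zero: "v S = 0" if "i \<notin> S" for S
    using nec that unfolding necessary_def by blast
  have inner: "share K (\<lambda>T. if T = {} then 0 else v (\<Union>R \<union> T)) i =
      (\<Sum>T | T \<noteq> {} \<and> T \<subset> K. v (\<Union>R \<union> T) / real (card T))" if R: "R \<subseteq> P - {K}" for R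
  proof -
    have "i \<notin> \<Union>R" using R K blocks_eq by blast
    then show ?thesis by (subst share_necessary) (auto intro!: zero sum.cong)
  qed
  \<comment> \<open>\<open>share_necessary\<close> asks for worth 0 at every \<open>R\<close>
    without \<open>K\<close>, even at families outside \<open>P\<close>, which might cover
    \<open>i\<close>. The cutoff \<open>R \<subseteq> P\<close> ensures this and does not change the
    share.\<close>
  have "share P (\<lambda>R. if R \<subseteq> P then v (\<Union>R) else 0) K =
      (\<Sum>R | R \<noteq> {} \<and> R \<subset> P. (if R \<subseteq> P then v (\<Union>R) else 0) / real (card R))"
    using K blocks_eq by (intro share_necessary) (auto intro!: zero)
  \<comment> \<open>The added term \<open>R = P\<close> is \<open>v UNIV\<close>, which is
    0.\<close>
  also have "\<dots> = (\<Sum>R | R \<noteq> {} \<and> R \<subseteq> P. v (\<Union>R) / real (card R))"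
    using v(2) partition_onD1[OF P] by (intro sum.mono_neutral_cong_left) auto
  also have "share P (\<lambda>R. if R \<subseteq> P then v (\<Union>R) else 0) K = share P (\<lambda>R. v (\<Union>R)) K"
    by (rule share_cong) auto
  finally have outer: "share P (\<lambda>R. v (\<Union>R)) K = (\<Sum>R | R \<noteq> {} \<and> R \<subseteq> P. v (\<Union>R) / real (card R))" .
  have "(\<Sum>R | R \<subseteq> P - {K}. share K (\<lambda>T. if T = {} then 0 else v (\<Union>R \<union> T)) i) =
      (\<Sum>R | R \<subseteq> P - {K}. \<Sum>T | T \<noteq> {} \<and> T \<subset> K. v (\<Union>R \<union> T) / real (card T))"
    by (rule sum.cong) (auto intro: inner)
  then show ?thesis
    by (simp add: gamma_C_share[where v = v, OF K v(1)] outer v(2))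
qed

section \<open>Zero-normalization and the totals of \<open>Gamma_C\<close>\<close>

lemma zero_normalized_Union:
  assumes "R \<subseteq> P"
  shows "zero_normalized v P (\<Union>R) = v (\<Union>R) - (\<Sum>K\<in>R. v K)"
  unfolding zero_normalized_def Let_def blocks_in_Union[OF assms] by simp

lemma zero_normalized_UNIV: "zero_normalized v P UNIV = v UNIV - (\<Sum>K\<in>P. v K)"
  using zero_normalized_Union[of P v] partition_onD1[OF P] by simp

lemma zero_normalized_empty: "zero_normalized v P {} = v {}"
  using zero_normalized_Union[of "{}" v] by simp

lemma zero_normalized_add:
  "zero_normalized (\<lambda>S. v S + w S) P = (\<lambda>S. zero_normalized v P S + zero_normalized w P S)"
  unfolding zero_normalized_def Let_def by (simp add: fun_eq_iff sum.distrib)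

lemma zero_normalized_necessary:
  assumes "necessary v i"
  shows "necessary (zero_normalized v P) i"
  unfolding necessary_def
proof (intro allI impI)
  fix S assume S: "S \<subseteq> UNIV - {i}"
  have zero: "v T = 0" if "T \<subseteq> S" for T
    using assms that S unfolding necessary_def by blast
  have "(\<Sum>K\<in>{K \<in> P. K \<subseteq> S}. v K) = 0" "(\<Sum>j\<in>S - \<Union>{K \<in> P. K \<subseteq> S}. v {j}) = 0"
    by (auto intro!: sum.neutral zero)
  then show "zero_normalized v P S = 0"
    unfolding zero_normalized_def Let_def by (simp add: zero)
qed

lemma zero_normalized_symmetric:
  assumes K: "K \<in> P" "i \<in> K" "j \<in> K" and sym: "symmetric_players v i j"
  shows "symmetric_players (zero_normalized v P) i j"
proof (cases "i = j")
  case False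
  show ?thesis
    unfolding symmetric_players_def
  proof (intro allI impI)
    fix S assume S: "S \<subseteq> UNIV - {i, j}"
    \<comment> \<open>A union completed by adding \<open>x\<close> would be \<open>K\<close>, which
      also contains the other one of \<open>i\<close> and \<open>j\<close>, still missing.\<close>
    have blocks: "{L \<in> P. L \<subseteq> S \<union> {x}} = {L \<in> P. L \<subseteq> S}" if "x \<in> {i, j}" for x
    proof -
      have "x \<notin> L" if "L \<in> P" "L \<subseteq> S \<union> {x}" for L
        using that \<open>x \<in> {i, j}\<close> blocks_eq[of K L x] K S False by auto
      then show ?thesis by blast
    qed
    define B where "B = \<Union>{L \<in> P. L \<subseteq> S}"
    have singles: "(\<Sum>k\<in>S \<union> {x} - B. v {k}) = v {x} + (\<Sum>k\<in>S - B. v {k})" if "x \<in> {i, j}" for x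
    proof -
      have "x \<notin> S" "B \<subseteq> S" using that S by (auto simp: B_def)
      then have "S \<union> {x} - B = insert x (S - B)" by auto
      then show ?thesis using \<open>x \<notin> S\<close> by simp
    qed
    have "v (S \<union> {i}) = v (S \<union> {j})" and "v {i} = v {j}"
      using sym S unfolding symmetric_players_def by (auto dest: spec[of _ "{}"])
    then show "zero_normalized v P (S \<union> {i}) = zero_normalized v P (S \<union> {j})"
      using blocks[of i] blocks[of j] singles[of i] singles[of j]
      unfolding zero_normalized_def Let_def B_def by simp
  qed
qed (simp add: symmetric_players_def)

text \<open>The singleton worths cancel against the per capita correction, leaving
  \<open>v K\<close>; the rest is \<open>sum_gamma_C\<close> for the zero-normalized game.
  Efficiency and symmetry among unions both start from this total.\<close>

lemma sum_Gamma_C: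
  assumes K: "K \<in> P" and v: "v {} = 0"
  shows "(\<Sum>i\<in>K. Gamma_C v P i) =
    v K + 1 / 2 ^ (card P - 1) * share P (\<lambda>R. zero_normalized v P (\<Union>R)) K
      + (v UNIV - (\<Sum>L\<in>P. v L)) / real (card P)"
proof -
  have "card K \<noteq> 0" using block_nonempty[OF K] by simp
  moreover have "(\<Sum>i\<in>K. Gamma_C v P i) = (\<Sum>i\<in>K. v {i} + (v K - (\<Sum>j\<in>K. v {j})) / real (card K)
      + gamma_C (zero_normalized v P) P i)"
    by (rule sum.cong) (simp_all add: Gamma_C_def Let_def union_of_eq[OF K])
  ultimately show ?thesis
    by (simp add: sum.distrib sum_gamma_C[OF K] zero_normalized_empty v zero_normalized_UNIV)
qed

section \<open>Uniqueness\<close>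

text \<open>
  Apart from \<open>UNIV\<close>, the game \<open>v\<close> charges at most \<open>Z\<close>; so players outside \<open>Z\<close> in the same union are
  symmetric, as are unions not contained in \<open>Z\<close>, and players in \<open>Z\<close> are necessary.
\<close>

lemma agree_two_coalitions:
  assumes g: "necessary_players_mean g" "efficiency g" "symmetry_inside_unions g"
      "symmetry_among_unions g"
    and h: "necessary_players_mean h" "efficiency h" "symmetry_inside_unions h"
      "symmetry_among_unions h"
    and v: "v {} = 0" and supp: "\<And>S. S \<noteq> Z \<Longrightarrow> S \<noteq> UNIV \<Longrightarrow> v S = 0"
    and Z: "Z = {} \<or> v UNIV = (\<Sum>K\<in>P. v K)"
  shows "g v P i = h v P i"
proof -
  define d where "d i = g v P i - h v P i" for i
  have game: "(v, P) \<in> cs_games" using v P by (simp add: cs_games_def)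
  have in_Z: "d i = 0" if "i \<in> Z" for i
  proof -
    obtain K where K: "K \<in> P" "i \<in> K" using ex_block by auto
    have "necessary v i" using supp that unfolding necessary_def by blast
    moreover have "v UNIV = (\<Sum>K\<in>P. v K)" using Z that by auto
    ultimately show ?thesis
      using bspec[OF g(1)[unfolded necessary_players_mean_def] game]
        bspec[OF h(1)[unfolded necessary_players_mean_def] game] K
      by (simp add: d_def)
  qed
  have inside: "d i = d j" if "K \<in> P" "i \<in> K - Z" "j \<in> K - Z" for K i j
  proof (cases "i = j")
    case False
    \<comment> \<open>Either set contains a player outside \<open>Z\<close>, so it is not
      \<open>Z\<close>, and misses one of \<open>i\<close>, \<open>j\<close>, so it is not
      \<open>UNIV\<close>.\<close>
    have "v (S \<union> {i}) = 0" "v (S \<union> {j}) = 0" if "S \<subseteq> UNIV - {i, j}" for S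
      using that False \<open>i \<in> K - Z\<close> \<open>j \<in> K - Z\<close> by (blast intro: supp)+
    then have "symmetric_players v i j" unfolding symmetric_players_def by simp
    then have "g v P i = g v P j" "h v P i = h v P j"
      using bspec[OF g(3)[unfolded symmetry_inside_unions_def] game]
        bspec[OF h(3)[unfolded symmetry_inside_unions_def] game] that
      by blast+
    then show ?thesis by (simp add: d_def)
  qed simp
  have among: "sum d K = sum d L" if KL: "K \<in> P" "L \<in> P" "\<not> K \<subseteq> Z" "\<not> L \<subseteq> Z" for K L
  proof (cases "K = L")
    case False
    have "v (\<Union>R \<union> K) = 0" "v (\<Union>R \<union> L) = 0" if R: "R \<subseteq> P - {K, L}" for R
    proof -
      obtain x y where xy: "x \<in> K" "y \<in> L" using block_nonempty KL by blast
      \<comment> \<open>A block covering \<open>y\<close> must be \<open>L\<close>, which is neither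
        in \<open>R\<close> nor equal to \<open>K\<close>; so \<open>\<Union>R \<union> K\<close>
        misses \<open>y\<close>. The same argument with \<open>x\<close> serves
        \<open>\<Union>R \<union> L\<close>.\<close>
      have "M = L" if "M \<in> R \<union> {K}" "y \<in> M" for M
        using that R xy KL blocks_eq[of M L y] by auto
      then have "\<Union>R \<union> K \<noteq> UNIV" using R False by blast
      moreover have "M = K" if "M \<in> R \<union> {L}" "x \<in> M" for M
        using that R xy KL blocks_eq[of M K x] by auto
      then have "\<Union>R \<union> L \<noteq> UNIV" using R False by blast
      moreover have "\<Union>R \<union> K \<noteq> Z" "\<Union>R \<union> L \<noteq> Z" using KL by auto
      ultimately show "v (\<Union>R \<union> K) = 0" "v (\<Union>R \<union> L) = 0" by (simp_all add: supp)
    qed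
    then have "symmetric_unions v P K L" unfolding symmetric_unions_def by simp
    then have "sum (g v P) K = sum (g v P) L" "sum (h v P) K = sum (h v P) L"
      using bspec[OF g(4)[unfolded symmetry_among_unions_def] game]
        bspec[OF h(4)[unfolded symmetry_among_unions_def] game] KL
      by blast+
    then show ?thesis by (simp add: d_def sum_subtractf)
  qed simp
  have total: "(\<Sum>K\<in>P. sum d K) = 0"
    using bspec[OF g(2)[unfolded efficiency_def] game] bspec[OF h(2)[unfolded efficiency_def] game]
    by (simp add: sum_blocks[symmetric] d_def sum_subtractf)
  \<comment> \<open>Blocks inside \<open>Z\<close> contribute 0 and all others contribute one common
    value, which the total 0 forces to vanish. The same argument is then repeated for the players of
    \<open>K - Z\<close>.\<close>
  have block_sum: "sum d K = 0" if "K \<in> P" for K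
  proof (cases "K \<subseteq> Z")
    case True
    then show ?thesis by (auto intro!: sum.neutral in_Z)
  next
    case False
    let ?Q = "{L \<in> P. \<not> L \<subseteq> Z}"
    have "(\<Sum>L\<in>P. sum d L) = (\<Sum>L\<in>?Q. sum d L)"
      by (rule sum.mono_neutral_right) (auto intro!: sum.neutral in_Z)
    also have "\<dots> = (\<Sum>L\<in>?Q. sum d K)"
      using that False by (intro sum.cong refl among) auto
    finally have "real (card ?Q) * sum d K = 0" using total by simp
    moreover have "card ?Q \<noteq> 0" using that False by auto
    ultimately show ?thesis by simp
  qed
  have "d i = 0"
  proof (cases "i \<in> Z")
    case False
    obtain K where K: "K \<in> P" "i \<in> K" using ex_block by auto
    have "sum d K = sum d (K - Z)"
      by (rule sum.mono_neutral_right) (auto intro: in_Z)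
    also have "\<dots> = (\<Sum>j\<in>K - Z. d i)"
      using K False by (intro sum.cong refl inside[of K]) auto
    finally have "real (card (K - Z)) * d i = 0" using block_sum[OF K(1)] by simp
    moreover have "card (K - Z) \<noteq> 0" using K False by auto
    ultimately show ?thesis by simp
  qed (rule in_Z)
  then show ?thesis by (simp add: d_def)
qed

text \<open>Additivity allows a game on the grand coalition to be added and later removed, because
  such games are settled by efficiency and the symmetries alone (\<open>Z = {}\<close> in
  \<open>agree_two_coalitions\<close>).\<close>

lemma agree_dirac:
  assumes g: "additivity g" "necessary_players_mean g" "efficiency g" "symmetry_inside_unions g"
      "symmetry_among_unions g"
    and h: "additivity h" "necessary_players_mean h" "efficiency h" "symmetry_inside_unions h"
      "symmetry_among_unions h"
    and Z: "Z \<noteq> {}"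
  shows "g (\<lambda>S. if S = Z then c else 0) P i = h (\<lambda>S. if S = Z then c else 0) P i"
proof -
  note agree = agree_two_coalitions[OF g(2-) h(2-)]
  have grand: "g (\<lambda>S. if S = UNIV then a else 0) P i = h (\<lambda>S. if S = UNIV then a else 0) P i" for a
    by (rule agree[where Z = "{}"]) auto
  show ?thesis
  proof (cases "Z = UNIV")
    case False
    \<comment> \<open>Adding \<open>c\<close> to the worth of the grand coalition restores the hypothesis
      \<open>v UNIV = (\<Sum>K\<in>P. v K)\<close> of the axiom on necessary players when \<open>Z\<close> is a union.\<close>
    define a where "a = (if Z \<in> P then c else 0)"
    let ?v = "\<lambda>S. if S = Z then c else (0::real)"
    let ?w = "\<lambda>S. if S = UNIV then a else (0::real)"
    have "(\<Sum>K\<in>P. ?v K + ?w K) = a"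
    proof -
      \<comment> \<open>If \<open>UNIV\<close> were a union too, the correction \<open>a\<close>
        would be counted among the worths of the unions and the balance would fail.\<close>
      have "UNIV \<notin> P" if "Z \<in> P"
        using that Z False blocks_eq[of Z UNIV] by blast
      then show ?thesis by (auto simp: sum.distrib a_def)
    qed
    then have "g (\<lambda>S. ?v S + ?w S) P i = h (\<lambda>S. ?v S + ?w S) P i"
      using Z False by (intro agree[where Z = Z]) auto
    moreover have "(?v, P) \<in> cs_games" "(?w, P) \<in> cs_games"
      using P Z by (auto simp: cs_games_def)
    then have "g (\<lambda>S. ?v S + ?w S) P i = g ?v P i + g ?w P i"
      and "h (\<lambda>S. ?v S + ?w S) P i = h ?v P i + h ?w P i"
      using g(1) h(1) unfolding additivity_def by blast+
    ultimately show ?thesis using grand[of a] by simp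
  qed (use grand in simp)
qed

text \<open>The game \<open>v\<close> is built up one coalition at a time, by induction on the set
  \<open>F\<close> of coalitions whose worth is retained.\<close>

lemma agree:
  assumes g: "additivity g" "necessary_players_mean g" "efficiency g" "symmetry_inside_unions g"
      "symmetry_among_unions g"
    and h: "additivity h" "necessary_players_mean h" "efficiency h" "symmetry_inside_unions h"
      "symmetry_among_unions h"
    and v: "v {} = 0"
  shows "g v P i = h v P i"
proof -
  have part: "g (\<lambda>S. if S \<in> F then v S else 0) P i = h (\<lambda>S. if S \<in> F then v S else 0) P i"
    if "finite F" for F
    using that
  proof induction
    case empty
    show ?case using agree_two_coalitions[OF g(2-) h(2-), of "\<lambda>S. 0" "{}"] by simp
  next
    case (insert Z F)
    let ?v = "\<lambda>S. if S = Z then v Z else 0" and ?w = "\<lambda>S. if S \<in> F then v S else 0"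
    have split: "(\<lambda>S. if S \<in> insert Z F then v S else 0) = (\<lambda>S. ?v S + ?w S)"
      using insert.hyps by auto
    show ?case
    \<comment> \<open>A worth charged to the empty coalition is no game, so
      \<open>agree_dirac\<close> does not cover it; but \<open>v {} = 0\<close>, and nothing is
      added.\<close>
    proof (cases "Z = {}")
      case True
      then have "(\<lambda>S. if S \<in> insert Z F then v S else 0) = ?w" using v by auto
      then show ?thesis using insert.IH by (simp only:)
    next
      case False
      have "(?v, P) \<in> cs_games" "(?w, P) \<in> cs_games"
        using P v False by (auto simp: cs_games_def)
      then have "g (\<lambda>S. ?v S + ?w S) P i = g ?v P i + g ?w P i"
        and "h (\<lambda>S. ?v S + ?w S) P i = h ?v P i + h ?w P i"
        using g(1) h(1) unfolding additivity_def by blast+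
      then show ?thesis
        unfolding split using insert.IH agree_dirac[OF g h False] by simp
    qed
  qed
  show ?thesis using part[of UNIV] by simp
qed

end

section \<open>The five axioms for \<open>Gamma_C\<close>\<close>

lemma additivity_Gamma_C: "additivity Gamma_C"
  unfolding additivity_def
proof (intro allI impI)
  fix v w :: "'n::finite game" and P i
  assume "(v, P) \<in> cs_games" "(w, P) \<in> cs_games"
  then have P: "partition_on UNIV P" and "v {} = 0" "w {} = 0" by (auto simp: cs_games_def)
  then show "Gamma_C (\<lambda>S. v S + w S) P i = Gamma_C v P i + Gamma_C w P i"
    unfolding Gamma_C_def Let_def zero_normalized_add[OF P]
    by (subst gamma_C_add[OF P])
       (simp_all add: zero_normalized_empty[OF P] sum.distrib add_divide_distrib diff_divide_distrib)
qed

text \<open>The hypothesis on \<open>v UNIV\<close> says exactly that the zero-normalized worth of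
  the grand coalition is 0, as \<open>gamma_C_necessary\<close> requires.\<close>

lemma necessary_players_mean_Gamma_C: "necessary_players_mean Gamma_C"
  unfolding necessary_players_mean_def
proof (safe, goal_cases)
  case (1 v P K i)
  then have P: "partition_on UNIV P" and v: "v {} = 0" by (auto simp: cs_games_def)
  have "zero_normalized v P {} = 0" "zero_normalized v P UNIV = 0"
    using 1 v by (simp_all add: zero_normalized_empty[OF P] zero_normalized_UNIV[OF P])
  then show ?case
    using gamma_C_necessary[OF P 1(3,4) _ _ zero_normalized_necessary[OF P 1(5)]]
    by (simp add: Gamma_C_def union_of_eq[OF P 1(3,4)])
qed

text \<open>Summed over the unions, the shares in the quotient game cancel, and the equal parts of
  the surplus complete the worths of the unions to \<open>v UNIV\<close>.\<close>

lemma efficiency_Gamma_C: "efficiency Gamma_C"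
  unfolding efficiency_def
proof (safe, goal_cases)
  case (1 v P)
  then have P: "partition_on UNIV P" and v: "v {} = 0" by (auto simp: cs_games_def)
  have "(\<Sum>K\<in>P. share P (\<lambda>R. zero_normalized v P (\<Union>R)) K) = 0"
    by (rule sum_share) (simp_all add: zero_normalized_empty[OF P] v)
  moreover have "P \<noteq> {}" using ex_block[OF P] by blast
  ultimately show ?case
    by (simp add: sum_blocks[OF P] sum_Gamma_C[where v = v, OF P _ v] sum.distrib sum_divide_distrib[symmetric])
qed

lemma symmetry_inside_unions_Gamma_C: "symmetry_inside_unions Gamma_C"
  unfolding symmetry_inside_unions_def
proof (safe, goal_cases)
  case (1 v P K i j)
  then have P: "partition_on UNIV P" and v: "v {} = 0" by (auto simp: cs_games_def)
  have "v {i} = v {j}"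
    using 1(5) unfolding symmetric_players_def by (auto dest: spec[of _ "{}"])
  moreover have "gamma_C (zero_normalized v P) P i = gamma_C (zero_normalized v P) P j"
    using 1 v by (intro gamma_C_symmetric[OF P, of K])
      (auto simp: zero_normalized_empty[OF P] intro: zero_normalized_symmetric[OF P])
  ultimately show ?case
    using 1 by (simp add: Gamma_C_def union_of_eq[OF P])
qed

text \<open>Taking \<open>R = {}\<close> gives \<open>v K = v L\<close>, so subtracting the worths
  of the unions leaves \<open>K\<close> and \<open>L\<close> symmetric in the quotient game, and
  \<open>share_symmetric\<close> applies to it.\<close>

lemma symmetry_among_unions_Gamma_C: "symmetry_among_unions Gamma_C"
  unfolding symmetry_among_unions_def
proof (safe, goal_cases)
  case (1 v P K L)
  then have P: "partition_on UNIV P" and v: "v {} = 0" by (auto simp: cs_games_def)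
  have sym: "v (\<Union>R \<union> K) = v (\<Union>R \<union> L)" if "R \<subseteq> P - {K, L}" for R
    using 1(4) that unfolding symmetric_unions_def by blast
  have eq: "v K = v L" using sym[of "{}"] by simp
  have "share P (\<lambda>R. zero_normalized v P (\<Union>R)) K = share P (\<lambda>R. zero_normalized v P (\<Union>R)) L"
  proof (rule share_symmetric)
    fix R assume R: "R \<subseteq> P - {K, L}"
    then have "insert K R \<subseteq> P" "insert L R \<subseteq> P" "K \<notin> R" "L \<notin> R" using 1 by auto
    then show "zero_normalized v P (\<Union>(insert K R)) = zero_normalized v P (\<Union>(insert L R))"
      using sym[OF R] eq by (simp only: zero_normalized_Union[OF P]) (simp add: Un_commute)
  qed (use 1 in auto)
  then show ?case using 1 eq by (simp add: sum_Gamma_C[where v = v, OF P _ v])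
qed

theorem theorem16:
  "(additivity (Gamma_C :: 'n::finite coal_value) \<and>
    necessary_players_mean (Gamma_C :: 'n coal_value) \<and>
    efficiency (Gamma_C :: 'n coal_value) \<and>
    symmetry_inside_unions (Gamma_C :: 'n coal_value) \<and>
    symmetry_among_unions (Gamma_C :: 'n coal_value)) \<and>
   (\<forall>g :: 'n coal_value.
      additivity g \<and> necessary_players_mean g \<and> efficiency g \<and>
      symmetry_inside_unions g \<and> symmetry_among_unions g \<longrightarrow>
      (\<forall>(v, P)\<in>cs_games. g v P = Gamma_C v P))"
proof -
  note axioms_Gamma_C = additivity_Gamma_C necessary_players_mean_Gamma_C efficiency_Gamma_C
    symmetry_inside_unions_Gamma_C symmetry_among_unions_Gamma_C
  have "g v P = Gamma_C v P"
    if "additivity g" "necessary_players_mean g" "efficiency g" "symmetry_inside_unions g"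
      "symmetry_among_unions g" "(v, P) \<in> cs_games" for g :: "'n coal_value" and v P
    using that(6) agree[OF _ that(1-5) axioms_Gamma_C] by (auto simp: cs_games_def)
  then show ?thesis using axioms_Gamma_C by blast
qed

end
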